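(* Let $Y,Y_1,Y_2,\ldots$ be i.i.d. real random variables with common moment generating function $m(\lambda)=\mathbb{E}e^{\lambda Y}$, and assume that the equation $\mathbb{E}e^{\lambda Y}=1$ has a positive root $\lambda^{\ast}>0$ and that $\mathbb{E}Y<0$. Let $\{W_n\}$ be the CUSUM process generated by $Y_1,Y_2,\ldots$ and $M_n(\lambda)=\mathbb{E}e^{\lambda W_n}$. Then $M_n(\lambda)$ has the following behavior in $n$: (i) for $0<\lambda<\lambda^{\ast}$, $M_n(\lambda)$ is bounded from above: $M_n(\lambda)\le c\,n^{\omega}$ for all $n\ge1$, where $\omega=\lambda/\lambda^{\ast}<1$ and $c>0$ is a constant not depending on $n$; (ii) for $\lambda=\lambda^{\ast}$, $M_n(\lambda)$ has a linear slant asymptote as $n\to\infty$; (iii) for $\lambda>\lambda^{\ast}$, $M_n(\lambda)$ is bounded from below: $M_n(\lambda)\ge\upsilon^{n}$, where $\upsilon=m(\lambda)>1$.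
   Context: The CUSUM process based on $Y_1,Y_2,\ldots$ is defined by $W_0=0$ and $W_{n+1}=\max\{W_n+Y_{n+1},0\}$. A sequence $b_n$ has a slant asymptote if there are real constants $a\ne0$ and $b$ with $b_n-(an+b)\to0$ as $n\to\infty$. Moment generating functions may take the value $+\infty$, and $\mathbb{E}Y$ may be $-\infty$. *)

theory Defs
  imports "HOL-Probability.Probability"
begin

definition mgf :: "'a measure \<Rightarrow> ('a \<Rightarrow> real) \<Rightarrow> real \<Rightarrow> ennreal" where
  "mgf M X lam = (\<integral>\<^sup>+ x. ennreal (exp (lam * X x)) \<partial>M)"

(* The Bochner integral is 0 on non-integrable functions, so an expectation that may be infinite
   is defined as E X^+ - E X^-.  In ereal, \<infinity> - \<infinity> = \<infinity>; hence "ext_expectation M X < 0"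
   holds only if E X^+ is finite. *)
definition ext_expectation :: "'a measure \<Rightarrow> ('a \<Rightarrow> real) \<Rightarrow> ereal" where
  "ext_expectation M X =
     enn2ereal (\<integral>\<^sup>+ x. ennreal (max (X x) 0) \<partial>M) - enn2ereal (\<integral>\<^sup>+ x. ennreal (max (- X x) 0) \<partial>M)"

(* The variable Y 0 is not used. *)
primrec cusum :: "(nat \<Rightarrow> 'a \<Rightarrow> real) \<Rightarrow> nat \<Rightarrow> 'a \<Rightarrow> real" where
  "cusum Y 0 x = 0"
| "cusum Y (Suc n) x = max (cusum Y n x + Y (Suc n) x) 0"

(* Stated for extended-real sequences; convergence of the difference to 0 forces s n to be finite
   for all large n. *)
definition has_slant_asymptote :: "(nat \<Rightarrow> ereal) \<Rightarrow> bool" where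
  "has_slant_asymptote s \<longleftrightarrow>
     (\<exists>a b :: real. a \<noteq> 0 \<and> (\<lambda>n. s n - ereal (a * real n + b)) \<longlonglongrightarrow> 0)"

end

theory Submission
  imports Defs
begin

text \<open>
  Write \<open>m\<close> for the moment generating function of \<open>Y\<close> and \<open>l\<close> for its positive root. Strict convexity
  gives \<open>m < 1\<close> on the interval from 0 to \<open>l\<close> and \<open>m > 1\<close> beyond \<open>l\<close>; the negative mean only serves to
  exclude \<open>Y = 0\<close>. Parts (i) and (iii) follow from \<open>m M\<^sub>n \<le> M\<^sub>n\<^sub>+\<^sub>1 \<le> m M\<^sub>n + 1\<close>; the bound in (i) is in
  fact uniform in \<open>n\<close>.

  At \<open>l\<close> the increment \<open>M\<^sub>n\<^sub>+\<^sub>1 - M\<^sub>n\<close> is the mean of the positive part of \<open>1 - exp (l (W\<^sub>n + Y\<^sub>n\<^sub>+\<^sub>1))\<close>.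
  Reversing time replaces \<open>W\<^sub>n\<close> by the maximum of the first \<open>n\<close> partial sums, which increases with
  \<open>n\<close>, so these increments decrease. Two consecutive ones differ at most by the probability that the
  walk is positive at time \<open>n + 1\<close>, which is at most \<open>m (l/2) ^ (n + 1)\<close>, so \<open>M\<^sub>n\<close> has an asymptote.
  Its slope cannot vanish: otherwise \<open>M\<^sub>n\<close> would be bounded.
\<close>

section \<open>Moment generating functions, laws of independent sums, and a criterion for
  asymptotes\<close>

lemma mgf_eq_nn_integral_distr:
  assumes "X \<in> borel_measurable M"
  shows "mgf M X lam = (\<integral>\<^sup>+ x. ennreal (exp (lam * x)) \<partial>distr M borel X)"
  unfolding mgf_def using assms by (subst nn_integral_distr) auto

text \<open>The graph of \<open>exp\<close> lies above its tangent at \<open>t * u\<close>.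
  Averaging the tangent bounds at 0 and at \<open>u\<close> with weights \<open>1 - t\<close> and
  \<open>t\<close> cancels the linear terms; strictness comes from the bound at 0.\<close>

lemma exp_less_chord:
  fixes t u :: real
  assumes "0 < t" "t < 1" "u \<noteq> 0"
  shows "exp (t * u) < 1 - t + t * exp u"
proof -
  define x where "x = exp (t * u)"
  have "x > 0" by (simp add: x_def)
  have "1 - t * u < exp (- (t * u))" using assms by (subst exp_minus_greater) auto
  then have "(1 - t) * (x * (1 - t * u)) < (1 - t) * (x * exp (- (t * u)))"
    using assms \<open>x > 0\<close> by simp
  also have "x * exp (- (t * u)) = 1" by (simp add: x_def flip: exp_add)
  finally have 1: "(1 - t) * (x * (1 - t * u)) < 1 - t" by simp
  have "t * (x * (1 + (1 - t) * u)) \<le> t * (x * exp ((1 - t) * u))"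
    using assms \<open>x > 0\<close> by (intro mult_left_mono exp_ge_add_one_self) auto
  also have "x * exp ((1 - t) * u) = exp u" by (simp add: x_def algebra_simps flip: exp_add)
  finally show ?thesis using 1 unfolding x_def[symmetric] by (simp add: algebra_simps)
qed

text \<open>Integrate the chord bound between the exponents 0 and \<open>l\<close>: the chord has
  mean at most 1, and equality almost everywhere would force \<open>X = 0\<close> almost
  surely.\<close>

lemma (in prob_space) mgf_less_one:
  assumes [measurable]: "X \<in> borel_measurable M"
    and nz: "\<not> (AE x in M. X x = 0)"
    and l: "0 < l'" "l' < l" and le: "mgf M X l \<le> 1"
  shows "mgf M X l' < 1"
proof -
  define t where "t = l' / l"
  have t: "0 < t" "t < 1" and l': "l' = t * l" using l by (auto simp: t_def)
  have chord: "exp (l' * x) \<le> 1 - t + t * exp (l * x)" for x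
    using exp_less_chord[OF t, of "l * x"] l by (cases "x = 0") (auto simp: l' mult.assoc)
  have chord_eq: "x = 0" if "1 - t + t * exp (l * x) \<le> exp (l' * x)" for x
    using exp_less_chord[OF t, of "l * x"] l that by (cases "x = 0") (auto simp: l' mult.assoc)
  have "(\<integral>\<^sup>+ x. ennreal (1 - t + t * exp (l * X x)) \<partial>M)
      = (\<integral>\<^sup>+ x. ennreal (1 - t) + ennreal t * ennreal (exp (l * X x)) \<partial>M)"
    using t by (intro nn_integral_cong) (simp add: ennreal_plus ennreal_mult)
  also have "\<dots> = ennreal (1 - t) + ennreal t * mgf M X l"
    by (simp add: nn_integral_add nn_integral_cmult emeasure_space_1 mgf_def)
  also have "\<dots> \<le> ennreal (1 - t) + ennreal t * 1"
    by (intro add_left_mono mult_left_mono le) auto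
  also have "\<dots> = 1" using t by (simp flip: ennreal_plus)
  finally have chord_le: "(\<integral>\<^sup>+ x. ennreal (1 - t + t * exp (l * X x)) \<partial>M) \<le> 1" .
  have "mgf M X l' \<le> (\<integral>\<^sup>+ x. ennreal (1 - t + t * exp (l * X x)) \<partial>M)"
    unfolding mgf_def by (intro nn_integral_mono ennreal_leI chord)
  also note chord_le
  \<comment> \<open>A strict pointwise inequality survives integration only if the smaller integral
    is finite.\<close>
  finally have fin: "mgf M X l' \<noteq> \<infinity>" by (auto simp: top_unique)
  have "mgf M X l' < (\<integral>\<^sup>+ x. ennreal (1 - t + t * exp (l * X x)) \<partial>M)"
    unfolding mgf_def
  proof (rule nn_integral_less)
    show "(\<integral>\<^sup>+ x. ennreal (exp (l' * X x)) \<partial>M) \<noteq> \<infinity>" using fin by (simp add: mgf_def)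
    show "AE x in M. ennreal (exp (l' * X x)) \<le> ennreal (1 - t + t * exp (l * X x))"
      by (intro AE_I2 ennreal_leI chord)
    show "\<not> (AE x in M. ennreal (1 - t + t * exp (l * X x)) \<le> ennreal (exp (l' * X x)))"
    proof
      assume "AE x in M. ennreal (1 - t + t * exp (l * X x)) \<le> ennreal (exp (l' * X x))"
      then have "AE x in M. X x = 0" by eventually_elim (rule chord_eq, simp)
      with nz show False ..
    qed
  qed auto
  with chord_le show ?thesis by simp
qed

text \<open>By Tonelli, with no integrability assumption, so the product rule also covers infinite
  values.\<close>

lemma (in prob_space) mgf_add:
  assumes ind: "indep_var borel X borel Z"
  shows "mgf M (\<lambda>x. X x + Z x) lam = mgf M X lam * mgf M Z lam"
proof -
  have [measurable]: "X \<in> borel_measurable M" "Z \<in> borel_measurable M"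
    using ind by (auto dest: indep_var_rv1 indep_var_rv2)
  interpret X: prob_space "distr M borel X" by (rule prob_space_distr) simp
  interpret Z: prob_space "distr M borel Z" by (rule prob_space_distr) simp
  have "mgf M (\<lambda>x. X x + Z x) lam
      = (\<integral>\<^sup>+ p. ennreal (exp (lam * (fst p + snd p))) \<partial>distr M (borel \<Otimes>\<^sub>M borel) (\<lambda>x. (X x, Z x)))"
    unfolding mgf_def by (subst nn_integral_distr) auto
  also have "\<dots> = (\<integral>\<^sup>+ p. ennreal (exp (lam * (fst p + snd p))) \<partial>(distr M borel X \<Otimes>\<^sub>M distr M borel Z))"
    using ind by (simp add: indep_var_distribution_eq)
  also have "\<dots> = (\<integral>\<^sup>+ x. \<integral>\<^sup>+ z. ennreal (exp (lam * (x + z))) \<partial>distr M borel Z \<partial>distr M borel X)"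
    by (subst Z.nn_integral_fst[symmetric]) auto
  also have "\<dots> = (\<integral>\<^sup>+ x. ennreal (exp (lam * x)) * mgf M Z lam \<partial>distr M borel X)"
    by (simp add: mgf_eq_nn_integral_distr distrib_left exp_add ennreal_mult nn_integral_cmult)
  also have "\<dots> = mgf M X lam * mgf M Z lam"
    by (simp add: mgf_eq_nn_integral_distr[of X] nn_integral_multc)
  finally show ?thesis .
qed

text \<open>This drives the time reversal: it lets different variables with the same law be
  exchanged inside an independent sum.\<close>

lemma (in prob_space) distr_add_cong:
  assumes "indep_var borel X borel Z" "indep_var borel X' borel Z'"
    and "distr M borel X = distr M borel X'" "distr M borel Z = distr M borel Z'"
  shows "distr M borel (\<lambda>x. X x + Z x) = distr M borel (\<lambda>x. X' x + Z' x :: real)"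
proof -
  have *: "distr M borel (\<lambda>x. X x + Z x)
      = distr (distr M borel X \<Otimes>\<^sub>M distr M borel Z) borel (\<lambda>p. fst p + snd p :: real)"
    if ind: "indep_var borel X borel Z" for X Z
  proof -
    have [measurable]: "X \<in> borel_measurable M" "Z \<in> borel_measurable M"
      using ind by (auto dest: indep_var_rv1 indep_var_rv2)
    have "distr M borel X \<Otimes>\<^sub>M distr M borel Z = distr M (borel \<Otimes>\<^sub>M borel) (\<lambda>x. (X x, Z x))"
      using ind by (simp add: indep_var_distribution_eq)
    then show ?thesis by (simp add: distr_distr comp_def)
  qed
  show ?thesis using assms by (simp add: *)
qed

text \<open>The increments decrease to a limit \<open>a\<close>. Summing the gaps bounds
  \<open>d n - a\<close> by a geometric sequence, so the excesses over \<open>a\<close> are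
  summable; their sum plus \<open>m 0\<close> is the intercept. The slope may still be 0
  here.\<close>

lemma slant_asymptote_of_geometric_increments:
  fixes m d :: "nat \<Rightarrow> real"
  assumes step: "\<And>n. m (Suc n) = m n + d n" and d0: "\<And>n. 0 \<le> d n"
    and dec: "\<And>n. d (Suc n) \<le> d n" and gap: "\<And>n. d n - d (Suc n) \<le> C * r ^ n"
    and r: "0 \<le> r" "r < 1"
  obtains a b where "(\<lambda>n. m n - (a * real n + b)) \<longlonglongrightarrow> 0"
proof -
  have "decseq d" by (intro decseq_SucI dec)
  then obtain a where a: "d \<longlonglongrightarrow> a" "\<And>n. a \<le> d n"
    using decseq_convergent[of d 0] d0 by metis
  have lim: "(\<lambda>k. (C * r ^ n - C * r ^ (n + k)) / (1 - r)) \<longlonglongrightarrow> (C * r ^ n - C * 0) / (1 - r)" for n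
  proof -
    have "(\<lambda>k. r ^ k) \<longlonglongrightarrow> 0" using r by (intro LIMSEQ_realpow_zero)
    then have "(\<lambda>k. r ^ (n + k)) \<longlonglongrightarrow> 0"
      using LIMSEQ_ignore_initial_segment[of "\<lambda>k. r ^ k" 0 n] by (simp add: add.commute)
    then show ?thesis using r by (intro tendsto_intros) auto
  qed
  \<comment> \<open>The right-hand side is the sum of \<open>C * r ^ i\<close> over
    \<open>n \<le> i < n + k\<close>.\<close>
  have tele: "d n - d (n + k) \<le> (C * r ^ n - C * r ^ (n + k)) / (1 - r)" for n k
  proof (induction k)
    case (Suc k)
    have "d n - d (n + Suc k) \<le> (C * r ^ n - C * r ^ (n + k)) / (1 - r) + C * r ^ (n + k)"
      using Suc gap[of "n + k"] by simp
    also have "\<dots> = (C * r ^ n - C * r ^ (n + Suc k)) / (1 - r)"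
      using r by (simp add: field_simps)
    finally show ?case .
  qed simp
  have le: "d n - a \<le> C / (1 - r) * r ^ n" for n
  proof (rule LIMSEQ_le)
    show "(\<lambda>k. d n - d (n + k)) \<longlonglongrightarrow> d n - a"
      using LIMSEQ_ignore_initial_segment[OF a(1), of n] by (intro tendsto_intros) (simp add: add.commute)
    show "(\<lambda>k. (C * r ^ n - C * r ^ (n + k)) / (1 - r)) \<longlonglongrightarrow> C / (1 - r) * r ^ n"
      using lim[of n] by simp
    show "\<exists>N. \<forall>k\<ge>N. d n - d (n + k) \<le> (C * r ^ n - C * r ^ (n + k)) / (1 - r)"
      using tele by blast
  qed
  have "summable (\<lambda>n. d n - a)"
  proof (rule summable_comparison_test')
    show "summable (\<lambda>n. C / (1 - r) * r ^ n)" using r by (intro summable_mult summable_geometric) auto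
    show "norm (d n - a) \<le> C / (1 - r) * r ^ n" for n using le[of n] a(2)[of n] by simp
  qed
  then have "(\<lambda>n. \<Sum>k<n. d k - a) \<longlonglongrightarrow> (\<Sum>k. d k - a)" by (rule summable_LIMSEQ)
  moreover have "m n - (a * real n + (m 0 + (\<Sum>k. d k - a))) = (\<Sum>k<n. d k - a) - (\<Sum>k. d k - a)" for n
  proof -
    have "m n = m 0 + (\<Sum>k<n. d k)" by (induction n) (auto simp: step)
    then show ?thesis by (simp add: sum_subtractf)
  qed
  ultimately have "(\<lambda>n. m n - (a * real n + (m 0 + (\<Sum>k. d k - a)))) \<longlonglongrightarrow> 0"
    by (simp only: LIM_zero)
  then show ?thesis by (rule that)
qed

section \<open>Partial sums, their maximum, and dependence on blocks of variables\<close>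

primrec walk :: "(nat \<Rightarrow> 'a \<Rightarrow> real) \<Rightarrow> nat \<Rightarrow> nat \<Rightarrow> 'a \<Rightarrow> real" where
  "walk Y 0 k x = 0"
| "walk Y (Suc n) k x = Y (Suc k) x + walk Y n (Suc k) x"

text \<open>The maximum of the partial sums of \<open>Y (k+1), ..., Y (k+n)\<close>, the empty one included. Unlike
  \<open>cusum\<close>, the recursion peels off the first variable; so it is monotone in \<open>n\<close> pathwise, and equal to
  \<open>cusum\<close> in law.\<close>

primrec walk_max :: "(nat \<Rightarrow> 'a \<Rightarrow> real) \<Rightarrow> nat \<Rightarrow> nat \<Rightarrow> 'a \<Rightarrow> real" where
  "walk_max Y 0 k x = 0"
| "walk_max Y (Suc n) k x = max (Y (Suc k) x + walk_max Y n (Suc k) x) 0"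

lemma walk_max_nonneg: "0 \<le> walk_max Y n k x"
  by (cases n) auto

text \<open>One more variable at the far end contributes just one new partial sum, the full one. In
  the induction the first variable is added to both arguments of the maximum.\<close>

lemma walk_max_Suc: "walk_max Y (Suc n) k x = max (walk_max Y n k x) (walk Y (Suc n) k x)"
proof (induction n arbitrary: k)
  case (Suc n)
  show ?case
    by (subst walk_max.simps(2), subst Suc) auto
qed auto

lemma walk_le_walk_max: "walk Y n k x \<le> walk_max Y n k x"
  by (cases n) (auto simp: walk_max_Suc simp del: walk_max.simps(2) walk.simps(2))

text \<open>This and the next five lemmas are applied to coordinate maps on \<open>PiM\<close>, to
  exhibit each process as a measurable function of a block of variables. For \<open>walk\<close> and
  \<open>walk_max\<close> the block is a half-line, which stays valid when the recursion shifts
  \<open>k\<close>.\<close>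

lemma cusum_cong: "(\<And>i. i \<in> {1..n} \<Longrightarrow> Y i x = Z i z) \<Longrightarrow> cusum Y n x = cusum Z n z"
  by (induction n) auto

lemma walk_cong: "(\<And>i. i \<in> {Suc k..} \<Longrightarrow> Y i x = Z i z) \<Longrightarrow> walk Y n k x = walk Z n k z"
  by (induction n arbitrary: k) auto

lemma walk_max_cong: "(\<And>i. i \<in> {Suc k..} \<Longrightarrow> Y i x = Z i z) \<Longrightarrow> walk_max Y n k x = walk_max Z n k z"
  by (induction n arbitrary: k) auto

lemma borel_measurable_cusum:
  "(\<And>i. i \<in> {1..n} \<Longrightarrow> Y i \<in> borel_measurable M) \<Longrightarrow> cusum Y n \<in> borel_measurable M"
  by (induction n) (auto intro!: borel_measurable_max borel_measurable_add simp: cusum.simps[abs_def])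

lemma borel_measurable_walk:
  "(\<And>i. i \<in> {Suc k..} \<Longrightarrow> Y i \<in> borel_measurable M) \<Longrightarrow> walk Y n k \<in> borel_measurable M"
  by (induction n arbitrary: k) (auto intro!: borel_measurable_add simp: walk.simps[abs_def])

lemma borel_measurable_walk_max:
  "(\<And>i. i \<in> {Suc k..} \<Longrightarrow> Y i \<in> borel_measurable M) \<Longrightarrow> walk_max Y n k \<in> borel_measurable M"
  by (induction n arbitrary: k)
    (auto intro!: borel_measurable_max borel_measurable_add simp: walk_max.simps[abs_def])

section \<open>Independence and equality in law for an i.i.d. sequence\<close>

locale iid_sequence = prob_space M for M :: "'a measure" +
  fixes Y :: "nat \<Rightarrow> 'a \<Rightarrow> real"
  assumes indep: "indep_vars (\<lambda>_. borel) Y UNIV"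
    and ident: "\<And>i. distr M borel (Y i) = distr M borel (Y 0)"
begin

lemma measurable_Y [measurable]: "Y i \<in> borel_measurable M"
  using indep by (auto simp: indep_vars_def)

lemma measurable_cusum [measurable]: "cusum Y n \<in> borel_measurable M"
  by (intro borel_measurable_cusum) simp

lemma measurable_walk [measurable]: "walk Y n k \<in> borel_measurable M"
  by (intro borel_measurable_walk) simp

lemma measurable_walk_max [measurable]: "walk_max Y n k \<in> borel_measurable M"
  by (intro borel_measurable_walk_max) simp

lemma indep_disjoint_functions:
  fixes f g :: "(nat \<Rightarrow> real) \<Rightarrow> real"
  assumes "A \<inter> B = {}"
    and f: "f \<in> borel_measurable (PiM A (\<lambda>_. borel))" and g: "g \<in> borel_measurable (PiM B (\<lambda>_. borel))"
    and X: "\<And>x. X x = f (restrict (\<lambda>i. Y i x) A)" and Z: "\<And>x. Z x = g (restrict (\<lambda>i. Y i x) B)"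
  shows "indep_var borel X borel Z"
proof -
  have "X = f \<circ> (\<lambda>x. restrict (\<lambda>i. Y i x) A)" "Z = g \<circ> (\<lambda>x. restrict (\<lambda>i. Y i x) B)"
    using X Z by auto
  then show ?thesis
    using indep_var_compose[OF indep_var_restrict[OF indep \<open>A \<inter> B = {}\<close>] f g] by simp
qed

lemma indep_cusum: "indep_var borel (cusum Y n) borel (Y (Suc n))"
  by (rule indep_disjoint_functions[where A = "{1..n}" and B = "{Suc n}"
        and f = "cusum (\<lambda>i y. y i) n" and g = "\<lambda>y. y (Suc n)"])
    (auto intro!: borel_measurable_cusum cusum_cong)

lemma indep_walk: "indep_var borel (Y (Suc k)) borel (walk Y n (Suc k))"
  by (rule indep_disjoint_functions[where A = "{Suc k}" and B = "{Suc (Suc k)..}"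
        and f = "\<lambda>y. y (Suc k)" and g = "walk (\<lambda>i y. y i) n (Suc k)"])
    (auto intro!: borel_measurable_walk walk_cong)

lemma indep_walk_max: "indep_var borel (walk_max Y n (Suc k)) borel (Y (Suc k))"
  by (rule indep_disjoint_functions[where B = "{Suc k}" and A = "{Suc (Suc k)..}"
        and g = "\<lambda>y. y (Suc k)" and f = "walk_max (\<lambda>i y. y i) n (Suc k)"])
    (auto intro!: borel_measurable_walk_max walk_max_cong)

lemma distr_Y: "distr M borel (Y i) = distr M borel (Y j)"
  using ident[of i] ident[of j] by simp

lemma mgf_Y: "mgf M (Y i) lam = mgf M (Y 0) lam"
  by (simp add: mgf_eq_nn_integral_distr distr_Y[of i 0])

text \<open>Both recursions add an independent variable of the common law and then clip at 0, so
  equality in law passes from \<open>n\<close> to \<open>Suc n\<close>.\<close>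

lemma distr_walk_max: "distr M borel (walk_max Y n k) = distr M borel (cusum Y n)"
proof (induction n arbitrary: k)
  case 0
  show ?case by (simp add: walk_max.simps(1)[abs_def] cusum.simps(1)[abs_def])
next
  case (Suc n)
  have "distr M borel (walk_max Y (Suc n) k)
      = distr (distr M borel (\<lambda>x. walk_max Y n (Suc k) x + Y (Suc k) x)) borel (\<lambda>y. max y 0)"
    by (subst distr_distr) (auto simp: comp_def walk_max.simps[abs_def] add.commute)
  also have "distr M borel (\<lambda>x. walk_max Y n (Suc k) x + Y (Suc k) x)
      = distr M borel (\<lambda>x. cusum Y n x + Y (Suc n) x)"
    by (intro distr_add_cong indep_walk_max indep_cusum Suc distr_Y)
  also have "distr \<dots> borel (\<lambda>y. max y 0) = distr M borel (cusum Y (Suc n))"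
    by (subst distr_distr) (auto simp: comp_def cusum.simps[abs_def])
  finally show ?case .
qed

lemma distr_walk_max_step:
  "distr M borel (\<lambda>x. walk_max Y n (Suc k) x + Y (Suc k) x) = distr M borel (\<lambda>x. cusum Y n x + Y (Suc n) x)"
  by (intro distr_add_cong indep_walk_max indep_cusum distr_walk_max distr_Y)

lemma mgf_walk: "mgf M (walk Y n k) lam = mgf M (Y 0) lam ^ n"
proof (induction n arbitrary: k)
  case 0
  show ?case by (simp add: mgf_def emeasure_space_1)
next
  case (Suc n)
  show ?case
    using mgf_add[OF indep_walk, of k n lam] by (simp add: walk.simps[abs_def] Suc mgf_Y[of "Suc k"])
qed

lemma mgf_zero: "mgf M (\<lambda>_. 0) lam = 1"
  by (simp add: mgf_def emeasure_space_1)

section \<open>Recursive bounds for the CUSUM moment generating function, and its growth\<close>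

lemma mgf_cusum_step:
  "mgf M (\<lambda>x. cusum Y n x + Y (Suc n) x) lam = mgf M (cusum Y n) lam * mgf M (Y 0) lam"
  using mgf_add[OF indep_cusum, of n lam] by (simp add: mgf_Y[of "Suc n"])

lemma mgf_cusum_Suc_le:
  "mgf M (cusum Y (Suc n)) lam \<le> mgf M (cusum Y n) lam * mgf M (Y 0) lam + 1"
proof -
  have "mgf M (cusum Y (Suc n)) lam
      \<le> (\<integral>\<^sup>+ x. ennreal (exp (lam * (cusum Y n x + Y (Suc n) x))) + 1 \<partial>M)"
    unfolding mgf_def by (intro nn_integral_mono) (auto simp: max_def)
  also have "\<dots> = mgf M (\<lambda>x. cusum Y n x + Y (Suc n) x) lam + 1"
    by (simp add: nn_integral_add mgf_def emeasure_space_1)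
  finally show ?thesis by (simp add: mgf_cusum_step)
qed

lemma power_mgf_le_mgf_cusum:
  assumes "0 < lam"
  shows "mgf M (Y 0) lam ^ n \<le> mgf M (cusum Y n) lam"
proof (induction n)
  case (Suc n)
  have "mgf M (Y 0) lam ^ Suc n \<le> mgf M (cusum Y n) lam * mgf M (Y 0) lam"
    using Suc by (simp add: mult.commute mult_left_mono)
  also have "\<dots> = mgf M (\<lambda>x. cusum Y n x + Y (Suc n) x) lam" by (simp add: mgf_cusum_step)
  also have "\<dots> \<le> mgf M (cusum Y (Suc n)) lam"
    unfolding mgf_def using assms by (intro nn_integral_mono) auto
  finally show ?case .
qed (simp add: mgf_zero)

lemma mgf_cusum_bounded:
  assumes "mgf M (Y 0) lam < 1"
  obtains c :: real where "c > 0" "\<And>n. mgf M (cusum Y n) lam \<le> ennreal c"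
proof -
  obtain r where r: "mgf M (Y 0) lam = ennreal r" "0 \<le> r" "r < 1"
    using assms by (cases "mgf M (Y 0) lam") auto
  \<comment> \<open>The constant is the fixed point of the map from \<open>s\<close> to
    \<open>r * s + 1\<close>, and it is at least the initial value 1.\<close>
  have "mgf M (cusum Y n) lam \<le> ennreal (1 / (1 - r))" for n
  proof (induction n)
    case 0
    show ?case using r by (simp add: mgf_zero)
  next
    case (Suc n)
    have "mgf M (cusum Y (Suc n)) lam \<le> mgf M (cusum Y n) lam * ennreal r + 1"
      using mgf_cusum_Suc_le[of n lam] r by simp
    also have "\<dots> \<le> ennreal (1 / (1 - r)) * ennreal r + 1"
      by (intro add_right_mono mult_right_mono Suc) simp
    also have "\<dots> = ennreal (1 / (1 - r) * r + 1)"
      using r by (simp add: ennreal_plus flip: ennreal_mult)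
    also have "1 / (1 - r) * r + 1 = 1 / (1 - r)" using r by (simp add: field_simps)
    finally show ?case .
  qed
  with that[of "1 / (1 - r)"] r show ?thesis by auto
qed

text \<open>The means form a convergent geometric series, so the series of the variables themselves
  is finite almost surely and its terms tend to 0.\<close>

lemma AE_exp_walk_tendsto_0:
  assumes "mgf M (Y 0) lam < 1"
  shows "AE x in M. (\<lambda>n. exp (lam * walk Y n k x)) \<longlonglongrightarrow> 0"
proof -
  obtain r where r: "mgf M (Y 0) lam = ennreal r" "0 \<le> r" "r < 1"
    using assms by (cases "mgf M (Y 0) lam") auto
  have "(\<integral>\<^sup>+ x. (\<Sum>n. ennreal (exp (lam * walk Y n k x))) \<partial>M) = (\<Sum>n. mgf M (walk Y n k) lam)"
    by (subst nn_integral_suminf) (auto simp: mgf_def)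
  also have "\<dots> = (\<Sum>n. ennreal (r ^ n))" by (simp add: mgf_walk r ennreal_power)
  also have "\<dots> = ennreal (\<Sum>n. r ^ n)" using r by (intro suminf_ennreal2 summable_geometric) auto
  finally have "AE x in M. (\<Sum>n. ennreal (exp (lam * walk Y n k x))) \<noteq> \<infinity>"
    by (intro nn_integral_noteq_infinite) auto
  then show ?thesis
  proof eventually_elim
    case (elim x)
    then have "summable (\<lambda>n. exp (lam * walk Y n k x))" by (intro summable_suminf_not_top) auto
    then show ?case by (rule summable_LIMSEQ_zero)
  qed
qed

text \<open>If the means were bounded, then \<open>exp (lam * walk)\<close>, which tends to 0 almost surely but has
  constant mean 1, would have an integrable majorant, the supremum of \<open>exp (lam * walk_max)\<close>.\<close>

lemma mgf_cusum_unbounded: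
  assumes "lam > 0" "mgf M (Y 0) lam = 1" "mgf M (Y 0) (lam / 2) < 1"
  shows "\<not> (\<forall>n. mgf M (cusum Y n) lam \<le> ennreal c)"
proof
  assume bound: "\<forall>n. mgf M (cusum Y n) lam \<le> ennreal c"
  define w where "w x = (SUP n. ennreal (exp (lam * walk_max Y n 0 x)))" for x
  have "incseq (\<lambda>n x. ennreal (exp (lam * walk_max Y n 0 x)))"
    using \<open>lam > 0\<close> by (intro incseq_SucI le_funI ennreal_leI)
      (simp add: walk_max_Suc del: walk_max.simps(2))
  \<comment> \<open>Pathwise monotonicity of \<open>walk_max\<close> moves the supremum out of the
    integral; equality in law then brings in the bound on \<open>cusum\<close>.\<close>
  then have "(\<integral>\<^sup>+ x. w x \<partial>M) = (SUP n. mgf M (walk_max Y n 0) lam)"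
    unfolding w_def mgf_def by (intro nn_integral_monotone_convergence_SUP) auto
  also have "\<dots> = (SUP n. mgf M (cusum Y n) lam)"
    by (simp add: mgf_eq_nn_integral_distr distr_walk_max)
  also have "\<dots> \<le> ennreal c" using bound by (intro SUP_least) auto
  also have "\<dots> < \<infinity>" by simp
  finally have w: "(\<integral>\<^sup>+ x. w x \<partial>M) < \<infinity>" .
  have "(\<lambda>n. (\<integral>\<^sup>+ x. ennreal (exp (lam * walk Y n 0 x)) \<partial>M)) \<longlonglongrightarrow> (\<integral>\<^sup>+ x. 0 \<partial>M)"
  proof (rule nn_integral_dominated_convergence[where w = w])
    show "w \<in> borel_measurable M" unfolding w_def by measurable
    show "AE x in M. ennreal (exp (lam * walk Y n 0 x)) \<le> w x" for n
      unfolding w_def using \<open>lam > 0\<close>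
      by (intro AE_I2 SUP_upper2[of n]) (auto simp: walk_le_walk_max)
    show "AE x in M. (\<lambda>n. ennreal (exp (lam * walk Y n 0 x))) \<longlonglongrightarrow> 0"
      using AE_exp_walk_tendsto_0[OF assms(3), of 0]
    proof eventually_elim
      case (elim x)
      \<comment> \<open>Almost sure convergence is available at \<open>lam / 2\<close>, where the
        moment generating function is below 1; squaring transfers it to \<open>lam\<close>.\<close>
      have "(\<lambda>n. ennreal (exp (lam / 2 * walk Y n 0 x) * exp (lam / 2 * walk Y n 0 x)))
          \<longlonglongrightarrow> ennreal (0 * 0)"
        by (intro tendsto_ennrealI tendsto_mult elim)
      moreover have "exp (lam / 2 * walk Y n 0 x) * exp (lam / 2 * walk Y n 0 x)
          = exp (lam * walk Y n 0 x)" for n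
        by (simp flip: exp_add)
      ultimately show ?case by simp
    qed
  qed (use w in auto)
  then have "(\<lambda>n. mgf M (walk Y n 0) lam) \<longlonglongrightarrow> 0" by (simp add: mgf_def)
  then have "(\<lambda>n::nat. 1 :: ennreal) \<longlonglongrightarrow> 0" by (simp add: mgf_walk assms(2))
  then show False by (simp add: LIMSEQ_const_iff)
qed

section \<open>The asymptote at the positive root\<close>

lemma mgf_cusum_slant_asymptote:
  assumes lam: "lam > 0" and root: "mgf M (Y 0) lam = 1" and half: "mgf M (Y 0) (lam / 2) < 1"
  shows "has_slant_asymptote (\<lambda>n. enn2ereal (mgf M (cusum Y n) lam))"
proof -
  define h where "h u = max 0 (1 - exp (lam * u))" for u :: real
  have [measurable]: "h \<in> borel_measurable borel" unfolding h_def by measurable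
  have h: "0 \<le> h u" "h u \<le> 1" for u by (auto simp: h_def)
  have h_antimono: "h v \<le> h u" if "u \<le> v" for u v
  proof -
    have "exp (lam * u) \<le> exp (lam * v)" using that lam by simp
    then show ?thesis unfolding h_def by (intro max.mono) simp_all
  qed
  \<comment> \<open>\<open>walk_max Y n 1\<close> starts at \<open>Y 2\<close>, so
    \<open>Y 1\<close> is independent of it and takes over the role of \<open>Y (Suc n)\<close>
    after the time reversal.\<close>
  define d where "d n = (\<integral>x. h (walk_max Y n 1 x + Y 1 x) \<partial>M)" for n
  have int: "integrable M (\<lambda>x. h (walk_max Y n 1 x + Y 1 x))" for n
    using h by (intro integrable_const_bound[where B = 1]) auto
  have d_nonneg: "0 \<le> d n" for n unfolding d_def using h by (intro integral_nonneg_AE) auto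
  have walk_max_mono: "walk_max Y n 1 x \<le> walk_max Y (Suc n) 1 x" for n x
    by (simp add: walk_max_Suc del: walk_max.simps(2))
  have d_dec: "d (Suc n) \<le> d n" for n
    unfolding d_def using walk_max_mono by (intro integral_mono int h_antimono) auto
  have step: "mgf M (cusum Y (Suc n)) lam = mgf M (cusum Y n) lam + ennreal (d n)" for n
  proof -
    have "mgf M (cusum Y (Suc n)) lam
        = (\<integral>\<^sup>+ x. ennreal (exp (lam * (cusum Y n x + Y (Suc n) x))) + ennreal (h (cusum Y n x + Y (Suc n) x)) \<partial>M)"
      unfolding mgf_def
    proof (rule nn_integral_cong)
      fix x
      \<comment> \<open>Clipping at 0 adds exactly \<open>h\<close>; the remaining term has the
        previous mean, since \<open>mgf M (Y 0) lam\<close> is 1.\<close>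
      have "exp (lam * max u 0) = exp (lam * u) + h u" for u
        using lam by (auto simp: h_def max_def mult_le_0_iff zero_le_mult_iff)
      then show "ennreal (exp (lam * cusum Y (Suc n) x))
          = ennreal (exp (lam * (cusum Y n x + Y (Suc n) x))) + ennreal (h (cusum Y n x + Y (Suc n) x))"
        using h by (simp add: ennreal_plus)
    qed
    also have "\<dots> = mgf M (\<lambda>x. cusum Y n x + Y (Suc n) x) lam
        + (\<integral>\<^sup>+ x. ennreal (h (cusum Y n x + Y (Suc n) x)) \<partial>M)"
      by (simp add: nn_integral_add mgf_def)
    also have "(\<integral>\<^sup>+ x. ennreal (h (cusum Y n x + Y (Suc n) x)) \<partial>M)
        = (\<integral>\<^sup>+ u. ennreal (h u) \<partial>distr M borel (\<lambda>x. cusum Y n x + Y (Suc n) x))"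
      by (subst nn_integral_distr) auto
    also have "\<dots> = (\<integral>\<^sup>+ u. ennreal (h u) \<partial>distr M borel (\<lambda>x. walk_max Y n 1 x + Y 1 x))"
      using distr_walk_max_step[of n 0] by simp
    also have "\<dots> = (\<integral>\<^sup>+ x. ennreal (h (walk_max Y n 1 x + Y 1 x)) \<partial>M)"
      by (subst nn_integral_distr) auto
    also have "\<dots> = ennreal (d n)"
      unfolding d_def using h by (intro nn_integral_eq_integral int) auto
    finally show ?thesis by (simp add: mgf_cusum_step root del: cusum.simps(2))
  qed
  obtain r where r: "mgf M (Y 0) (lam / 2) = ennreal r" "0 \<le> r" "r < 1"
    using half by (cases "mgf M (Y 0) (lam / 2)") auto
  have gap: "d n - d (Suc n) \<le> r * r ^ n" for n
  proof -
    let ?g = "\<lambda>x. h (walk_max Y n 1 x + Y 1 x) - h (walk_max Y (Suc n) 1 x + Y 1 x)"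
    \<comment> \<open>An exponential Markov bound: the two maxima differ only if the new full sum
      exceeds the old maximum, hence is positive. Then the right-hand side is at least 1, while
      \<open>h\<close> takes values between 0 and 1.\<close>
    have g_le: "?g x \<le> exp (lam / 2 * walk Y (Suc n) 1 x)" for x
    proof (cases "walk Y (Suc n) 1 x \<le> walk_max Y n 1 x")
      case True
      then show ?thesis by (simp add: walk_max_Suc del: walk_max.simps(2) walk.simps(2))
    next
      case False
      then have "0 \<le> lam / 2 * walk Y (Suc n) 1 x"
        using walk_max_nonneg[of Y n 1 x] lam by (simp del: walk.simps(2))
      then have "1 \<le> exp (lam / 2 * walk Y (Suc n) 1 x)" by simp
      moreover have "?g x \<le> 1"
        using h(2)[of "walk_max Y n 1 x + Y 1 x"] h(1)[of "walk_max Y (Suc n) 1 x + Y 1 x"] by linarith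
      ultimately show ?thesis by linarith
    qed
    have "ennreal (d n - d (Suc n)) = ennreal (\<integral>x. ?g x \<partial>M)"
      unfolding d_def by (subst Bochner_Integration.integral_diff[OF int int]) simp
    also have "\<dots> = (\<integral>\<^sup>+ x. ennreal (?g x) \<partial>M)"
      using walk_max_mono
      by (intro nn_integral_eq_integral[symmetric] Bochner_Integration.integrable_diff int AE_I2)
        (simp add: h_antimono del: walk_max.simps(2))
    also have "\<dots> \<le> mgf M (walk Y (Suc n) 1) (lam / 2)"
      unfolding mgf_def by (intro nn_integral_mono ennreal_leI g_le)
    also have "\<dots> = ennreal (r * r ^ n)" using r by (simp add: mgf_walk ennreal_power ennreal_mult)
    finally show ?thesis using r by (simp add: ennreal_le_iff)
  qed
  define m where "m n = enn2real (mgf M (cusum Y n) lam)" for n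
  have mgf_eq: "mgf M (cusum Y n) lam = ennreal (m n)" for n
  proof -
    \<comment> \<open>The value is 1 at time 0, and each step adds a finite amount.\<close>
    have "mgf M (cusum Y n) lam \<noteq> \<infinity>" by (induction n) (auto simp: mgf_zero step simp del: cusum.simps(2))
    then show ?thesis by (simp add: m_def less_top)
  qed
  have m_nonneg: "0 \<le> m n" for n by (simp add: m_def)
  have m_step: "m (Suc n) = m n + d n" for n
    using step[of n] m_nonneg d_nonneg by (simp add: mgf_eq flip: ennreal_plus)
  obtain a b where ab: "(\<lambda>n. m n - (a * real n + b)) \<longlonglongrightarrow> 0"
    using slant_asymptote_of_geometric_increments[OF m_step d_nonneg d_dec gap r(2,3)] by blast
  have "a \<noteq> 0"
  proof
    assume "a = 0"
    with ab have "m \<longlonglongrightarrow> b" by (simp add: LIM_zero_iff)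
    then obtain c where c: "\<And>n. m n \<le> c"
      using convergent_imp_Bseq[of m] unfolding convergent_def Bseq_def
      by (metis abs_le_iff real_norm_def)
    then show False
      using mgf_cusum_unbounded[OF assms, of c] by (auto simp: mgf_eq intro: ennreal_leI)
  qed
  moreover have "(\<lambda>n. enn2ereal (mgf M (cusum Y n) lam) - ereal (a * real n + b)) \<longlonglongrightarrow> 0"
    using ab m_nonneg by (simp add: mgf_eq zero_ereal_def)
  ultimately show ?thesis unfolding has_slant_asymptote_def by blast
qed

end

section \<open>The three regimes of the exponent\<close>

theorem theorem6p1:
  fixes M :: "'a measure" and Y :: "nat \<Rightarrow> 'a \<Rightarrow> real" and lams :: real
  assumes "prob_space M"
    and indep: "prob_space.indep_vars M (\<lambda>_. borel) Y UNIV"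
    and ident: "\<And>i. distr M borel (Y i) = distr M borel (Y 0)"
    and root: "lams > 0" "mgf M (Y 0) lams = 1"
    and neg: "ext_expectation M (Y 0) < 0"
  shows "(\<forall>lam. 0 < lam \<and> lam < lams \<longrightarrow>
            (let \<omega> = lam / lams in \<omega> < 1 \<and>
              (\<exists>c::real. c > 0 \<and>
                (\<forall>n\<ge>1. mgf M (cusum Y n) lam \<le> ennreal (c * real n powr \<omega>)))))
       \<and> has_slant_asymptote (\<lambda>n. enn2ereal (mgf M (cusum Y n) lams))
       \<and> (\<forall>lam. lam > lams \<longrightarrow>
            (let \<upsilon> = mgf M (Y 0) lam in \<upsilon> > 1 \<and>
              (\<forall>n. mgf M (cusum Y n) lam \<ge> \<upsilon> ^ n)))"
proof -
  interpret prob_space M by fact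
  interpret iid_sequence M Y by unfold_locales (fact indep, fact ident)
  have nz: "\<not> (AE x in M. Y 0 x = 0)"
  proof
    assume ae: "AE x in M. Y 0 x = 0"
    have "(\<integral>\<^sup>+ x. ennreal (max (Y 0 x) 0) \<partial>M) = 0" "(\<integral>\<^sup>+ x. ennreal (max (- Y 0 x) 0) \<partial>M) = 0"
      by (subst nn_integral_0_iff_AE; use ae in auto)+
    with neg show False by (simp add: ext_expectation_def)
  qed
  have less: "mgf M (Y 0) lam < 1" if "0 < lam" "lam < lams" for lam
    using that root by (intro mgf_less_one[OF _ nz, of lam lams]) auto
  have greater: "mgf M (Y 0) lam > 1" if "lam > lams" for lam
  proof (rule ccontr)
    assume "\<not> mgf M (Y 0) lam > 1"
    \<comment> \<open>Here \<open>lams\<close> is the interior exponent and \<open>lam\<close> the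
      right endpoint of the chord.\<close>
    then have "mgf M (Y 0) lams < 1"
      using that root by (intro mgf_less_one[OF _ nz, of lams lam]) auto
    with root show False by simp
  qed
  have "\<exists>c::real. c > 0 \<and> (\<forall>n\<ge>1. mgf M (cusum Y n) lam \<le> ennreal (c * real n powr (lam / lams)))"
    if lam: "0 < lam" "lam < lams" for lam
  proof -
    obtain c :: real where c: "c > 0" "\<And>n. mgf M (cusum Y n) lam \<le> ennreal c"
      using mgf_cusum_bounded[OF less[OF lam]] by blast
    have "mgf M (cusum Y n) lam \<le> ennreal (c * real n powr (lam / lams))" if "n \<ge> 1" for n
    proof -
      \<comment> \<open>The bound uniform in \<open>n\<close> suffices, because the power is at
        least 1 once \<open>n \<ge> 1\<close>.\<close>
      have "1 \<le> real n powr (lam / lams)" using that lam by (intro ge_one_powr_ge_zero) auto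
      then have "c \<le> c * real n powr (lam / lams)" using c(1) by simp
      then show ?thesis using c(2)[of n] by (meson ennreal_leI order_trans)
    qed
    with c(1) show ?thesis by blast
  qed
  moreover have "has_slant_asymptote (\<lambda>n. enn2ereal (mgf M (cusum Y n) lams))"
    using root less[of "lams / 2"] by (intro mgf_cusum_slant_asymptote) auto
  ultimately show ?thesis
    using root(1) greater power_mgf_le_mgf_cusum by (auto simp: Let_def)
qed

end
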